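(* Let $k>2$, and let $\mathcal D$ be a distribution over $\mathbb R^d$ with mean $0$ and $\sigma_k(\mathcal D)\le1$. Let $X_1,\dots,X_m\sim\mathcal D$ i.i.d. and $X=\frac1m\sum_{i=1}^mX_i$. There exists $t_1=O\big(\sqrt{d\log m/m}\big)$ such that for all $t\ge t_1$, \[ \Pr[\|X\|_2\ge t]=\tilde O\left(\frac{d^{k/2}}{m^{k-1}t^k}+e^{-mt^2/d}\right). \]
   Context: $\sigma_k(\mathcal D)=\sup_{\|v\|_2=1}\mathbb E_{Y\sim\mathcal D}[|\langle Y-\mathbb E Y,v\rangle|^k]^{1/k}$. $\tilde O$ hides factors depending only on $k$ and polylogarithmic factors in $m$. *)

theory Defs
  imports "HOL-Probability.Probability"
begin

text \<open>
  The constants of the theorem are uniform in the dimension \<open>d\<close>, so \<open>d\<close> is a natural number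
  rather than an index type: a vector of \<open>d\<close>-dimensional space is an extensional function
  \<open>nat \<Rightarrow> real\<close> with coordinates \<open>i < d\<close>, its Euclidean norm is \<open>L2_set x {..<d}\<close>.
\<close>

definition rvec :: "nat \<Rightarrow> (nat \<Rightarrow> real) set" where
  "rvec d = ({..<d} \<rightarrow>\<^sub>E UNIV)"

definition rvec_borel :: "nat \<Rightarrow> (nat \<Rightarrow> real) measure" where
  "rvec_borel d = Pi\<^sub>M {..<d} (\<lambda>_. borel)"

definition rvec_norm :: "nat \<Rightarrow> (nat \<Rightarrow> real) \<Rightarrow> real" where
  "rvec_norm d x = L2_set x {..<d}"

definition rvec_inner :: "nat \<Rightarrow> (nat \<Rightarrow> real) \<Rightarrow> (nat \<Rightarrow> real) \<Rightarrow> real" where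
  "rvec_inner d x y = (\<Sum>i<d. x i * y i)"

definition rvec_distribution :: "nat \<Rightarrow> (nat \<Rightarrow> real) measure \<Rightarrow> bool" where
  "rvec_distribution d D \<longleftrightarrow> prob_space D \<and> sets D = sets (rvec_borel d)"

definition mean_vec :: "nat \<Rightarrow> (nat \<Rightarrow> real) measure \<Rightarrow> (nat \<Rightarrow> real)" where
  "mean_vec d D = (\<lambda>i\<in>{..<d}. integral\<^sup>L D (\<lambda>y. y i))"

text \<open>Integrability is explicit, since the Bochner integral of a non-integrable function is 0.\<close>

definition mean_zero :: "nat \<Rightarrow> (nat \<Rightarrow> real) measure \<Rightarrow> bool" where
  "mean_zero d D \<longleftrightarrow>
     (\<forall>i<d. integrable D (\<lambda>y. y i)) \<and> mean_vec d D = (\<lambda>i\<in>{..<d}. 0)"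

definition ennreal_powr :: "ennreal \<Rightarrow> real \<Rightarrow> ennreal" where
  "ennreal_powr x a = (if x = top then top else ennreal (enn2real x powr a))"

text \<open>
  The value lies in \<open>[0, \<infinity>]\<close>, so that a bound \<open>\<sigma>\<^sub>k \<le> 1\<close> forces all directional \<open>k\<close>-th moments
  to be finite.
\<close>

definition sigma_moment :: "real \<Rightarrow> nat \<Rightarrow> (nat \<Rightarrow> real) measure \<Rightarrow> ennreal" where
  "sigma_moment k d D =
     (SUP v\<in>{v \<in> rvec d. rvec_norm d v = 1}.
        ennreal_powr
          (\<integral>\<^sup>+ y. ennreal (\<bar>rvec_inner d (\<lambda>i. y i - mean_vec d D i) v\<bar> powr k) \<partial>D)
          (1 / k))"

text \<open>
  A sample \<open>x\<close> of size \<open>m\<close> has entries \<open>x j\<close> for \<open>j < m\<close>; under \<open>iid_sample m D\<close> these are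
  i.i.d. with law \<open>D\<close>.
\<close>

definition iid_sample :: "nat \<Rightarrow> (nat \<Rightarrow> real) measure \<Rightarrow> (nat \<Rightarrow> nat \<Rightarrow> real) measure" where
  "iid_sample m D = Pi\<^sub>M {..<m} (\<lambda>_. D)"

definition sample_mean :: "nat \<Rightarrow> nat \<Rightarrow> (nat \<Rightarrow> nat \<Rightarrow> real) \<Rightarrow> (nat \<Rightarrow> real)" where
  "sample_mean d m x = (\<lambda>i\<in>{..<d}. (\<Sum>j<m. x j i) / real m)"

end

theory Submission
  imports Defs
begin

text \<open>
  Put \<open>s = m t\<^sup>2 / d\<close> and \<open>L = 2 k (1 + ln m)\<close>, and truncate the samples at norm \<open>B = m t / L\<close>.
  Since \<open>E \<parallel>X\<parallel>\<^sup>k \<le> d\<^bsup>k/2\<^esup>\<close>, a union bound shows that some sample exceeds \<open>B\<close> with probability at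
  most \<open>m d\<^bsup>k/2\<^esup> / B\<^sup>k\<close>, which is \<open>L\<^sup>k\<close> times the polynomial term of the claim. The truncated sum \<open>S\<close>
  is controlled by a Bennett type bound in Euclidean space following Pinelis: adding one
  independent summand multiplies \<open>E cosh (\<lambda> \<parallel>S\<parallel>)\<close> by at most
  \<open>1 + 3 e\<^bsup>2 \<lambda> B\<^esup> d / B\<^sup>2\<close>. Choosing \<open>e\<^bsup>2 \<lambda> B\<^esup> = s / L\<close> gives a tail of order \<open>(s / L)\<^bsup>- L / 4\<^esup>\<close>, again
  dominated by the polynomial term once \<open>s \<ge> e\<^bsup>12\<^esup> L\<close>. For \<open>m \<ge> 2\<close> the lower bound on \<open>t\<close> forces
  this; for \<open>m = 1\<close> the remaining \<open>s\<close> are bounded, so there the exponential term is bounded below.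
\<close>

section \<open>Scalar inequalities for \<open>cosh\<close>, \<open>exp\<close> and real
  powers\<close>

lemma cosh_sqrt_sums:
  fixes r :: real
  assumes "0 \<le> r"
  shows "(\<lambda>n. r ^ n / fact (2 * n)) sums cosh (sqrt r)"
proof -
  have "(\<lambda>n. (if even (2 * n) then sqrt r ^ (2 * n) /\<^sub>R fact (2 * n) else 0)) sums cosh (sqrt r)"
    using cosh_converges[of "sqrt r"]
    by (subst sums_mono_reindex[of "\<lambda>n. 2 * n" "\<lambda>n. if even n then sqrt r ^ n /\<^sub>R fact n else 0"])
       (auto simp: strict_mono_def elim!: evenE)
  then show ?thesis
    using assms by (simp add: power_mult divide_inverse_commute)
qed

lemma convex_on_power_nonneg: "convex_on {0::real..} (\<lambda>x. x ^ n)"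
  by (cases "even n") (auto intro: convex_power_odd convex_on_subset[OF convex_power_even])

text \<open>The power series of \<open>cosh\<close> has only even powers, so after inserting
  \<open>sqrt r\<close> it is a series in \<open>r\<close> with nonnegative coefficients. Each
  monomial is convex on the half-line, and the termwise inequality passes to the sums.\<close>

lemma convex_on_cosh_sqrt: "convex_on {0..} (\<lambda>r::real. cosh (sqrt r))"
proof (rule convex_onI)
  fix t x y :: real
  assume t: "0 < t" "t < 1" and xy: "x \<in> {0..}" "y \<in> {0..}"
  let ?z = "(1 - t) * x + t * y"
  have z: "0 \<le> ?z" using t xy by simp
  have *: "?z ^ n / fact (2 * n) \<le> (1 - t) * (x ^ n / fact (2 * n)) + t * (y ^ n / fact (2 * n))" for n
    using divide_right_mono[OF convex_onD[OF convex_on_power_nonneg[of n], of t x y], of "fact (2 * n)"] t xy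
    by (simp add: add_divide_distrib)
  have "cosh (sqrt ?z) \<le> (1 - t) * cosh (sqrt x) + t * cosh (sqrt y)"
    using xy by (intro sums_le[OF * cosh_sqrt_sums[OF z]] sums_add sums_mult cosh_sqrt_sums) auto
  then show "cosh (sqrt ((1 - t) *\<^sub>R x + t *\<^sub>R y)) \<le> (1 - t) * cosh (sqrt x) + t * cosh (sqrt y)"
    by simp
qed auto

text \<open>Multiply \<open>1 - b \<le> exp (- b)\<close> by \<open>1 + b\<close>, rearrange, and
  multiply by \<open>exp b\<close>. The quadratic factor is what later brings in the second
  moment.\<close>

lemma exp_minus_linear_le:
  fixes b :: real
  assumes "0 \<le> b"
  shows "exp b - 1 - b \<le> b\<^sup>2 * exp b"
proof -
  have "(1 + b) * (1 - b) \<le> (1 + b) * exp (- b)"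
    using assms exp_ge_add_one_self[of "- b"] by (intro mult_left_mono) auto
  then have "1 - (1 + b) * exp (- b) \<le> b\<^sup>2"
    by (simp add: algebra_simps power2_eq_square)
  then have "(1 - (1 + b) * exp (- b)) * exp b \<le> b\<^sup>2 * exp b"
    by (rule mult_right_mono) simp
  moreover have "(1 - (1 + b) * exp (- b)) * exp b = exp b - 1 - b"
    by (simp add: left_diff_distrib mult.assoc flip: exp_add)
  ultimately show ?thesis by simp
qed

lemma sinh_ge_self:
  fixes b :: real
  assumes "0 \<le> b"
  shows "b \<le> sinh b"
proof -
  have "b - sinh b \<le> 0 - sinh 0"
  proof (rule DERIV_nonpos_imp_nonincreasing[OF assms])
    fix x :: real
    have "((\<lambda>b. b - sinh b) has_real_derivative 1 - cosh x) (at x)"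
      by (auto intro!: derivative_eq_intros)
    then show "\<exists>y. ((\<lambda>b. b - sinh b) has_real_derivative y) (at x) \<and> y \<le> 0"
      using cosh_real_ge_1[of x] by auto
  qed
  then show ?thesis by simp
qed

text \<open>
  Here \<open>a\<close> and \<open>b\<close> are the lengths of two vectors with inner product \<open>c\<close>. The left side is convex
  and the right side affine in \<open>c\<close>, so only \<open>c = \<plusminus>ab\<close> has to be checked.
\<close>

lemma cosh_sqrt_increment:
  fixes a b c :: real
  assumes a: "0 \<le> a" and b: "0 \<le> b" and c: "\<bar>c\<bar> \<le> a * b"
  shows "cosh (sqrt (a\<^sup>2 + 2 * c + b\<^sup>2))
    \<le> cosh a + sinh a / a * c + (exp b - 1 - b) * cosh a"
proof -
  \<comment> \<open>The weight that makes \<open>a\<^sup>2 + 2 * c + b\<^sup>2\<close> a convex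
    combination of \<open>(a - b)\<^sup>2\<close> and \<open>(a + b)\<^sup>2\<close>. If
    \<open>a * b = 0\<close>, then \<open>c = 0\<close> and the quotient is zero, so
    \<open>t = 1 / 2\<close>.\<close>
  define t where "t = (1 + c / (a * b)) / 2"
  have t: "0 \<le> t" "t \<le> 1" and tc: "c = (2 * t - 1) * (a * b)"
  proof -
    have *: "\<bar>c / (a * b)\<bar> \<le> 1"
      using a b c by (cases "a * b = 0") (auto simp: divide_le_eq_1 abs_mult)
    then show "0 \<le> t" "t \<le> 1" by (auto simp: t_def abs_le_iff simp del: abs_divide)
    show "c = (2 * t - 1) * (a * b)"
      using c by (cases "a * b = 0") (auto simp: t_def add_divide_distrib)
  qed
  have tr: "0 \<le> sinh a" "sinh a \<le> cosh a"
    using a by (auto simp: sinh_le_cosh_real)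
  have sb: "0 \<le> sinh b - b" using sinh_ge_self[OF b] by simp
  \<comment> \<open>Split into even and odd part: \<open>cosh b - 1\<close> matches the addition
    formula exactly, and \<open>sinh b - b\<close> pays for replacing \<open>sinh b\<close> by
    \<open>b\<close> since \<open>sinh a \<le> cosh a\<close>.\<close>
  have e: "exp b - 1 - b = (cosh b - 1) + (sinh b - b)"
    by (simp add: cosh_plus_sinh[symmetric] algebra_simps)
  have sc: "sinh a * (sinh b - b) \<le> cosh a * (sinh b - b)" "0 \<le> sinh a * (sinh b - b)"
    "0 \<le> cosh a * (sinh b - b)"
    using tr sb by (auto intro!: mult_right_mono)
  have p: "cosh (a + b) \<le> cosh a + sinh a * b + (exp b - 1 - b) * cosh a"
    using sc unfolding e cosh_add by (simp add: algebra_simps)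
  have m: "cosh (a - b) \<le> cosh a - sinh a * b + (exp b - 1 - b) * cosh a"
    using sc unfolding e cosh_diff by (simp add: algebra_simps)
  have "a\<^sup>2 + 2 * c + b\<^sup>2 = (1 - t) * (a - b)\<^sup>2 + t * (a + b)\<^sup>2"
    unfolding tc by (simp add: power2_eq_square algebra_simps)
  then have "cosh (sqrt (a\<^sup>2 + 2 * c + b\<^sup>2)) \<le> (1 - t) * cosh \<bar>a - b\<bar> + t * cosh \<bar>a + b\<bar>"
    using convex_onD[OF convex_on_cosh_sqrt, of t "(a - b)\<^sup>2" "(a + b)\<^sup>2"] t by simp
  also have "\<dots> \<le> (1 - t) * (cosh a - sinh a * b + (exp b - 1 - b) * cosh a)
      + t * (cosh a + sinh a * b + (exp b - 1 - b) * cosh a)"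
    using p m t by (intro add_mono mult_left_mono) auto
  also have "\<dots> = cosh a + sinh a * b * (2 * t - 1) + (exp b - 1 - b) * cosh a"
    by (simp add: algebra_simps)
  also have "sinh a * b * (2 * t - 1) = sinh a / a * c"
    using tc by (cases "a = 0") auto
  finally show ?thesis .
qed

text \<open>The left side is the tangent at \<open>1\<close> of a convex function. Young's
  inequality with second factor \<open>1\<close> yields it, including at
  \<open>z = 0\<close>.\<close>

lemma powr_tangent_le:
  fixes z p :: real
  assumes "0 \<le> z" "1 < p"
  shows "1 + p * (z - 1) \<le> z powr p"
proof -
  have "z * 1 \<le> z powr p / p + 1 powr (p / (p - 1)) / (p / (p - 1))"
    using assms by (intro Youngs_inequality) (auto simp: field_simps)
  then have "z \<le> z powr p / p + (p - 1) / p" by simp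
  then have "z * p \<le> (z powr p / p + (p - 1) / p) * p"
    using assms by (intro mult_right_mono) auto
  also have "\<dots> = z powr p + (p - 1)"
    using assms by (simp add: distrib_right)
  finally show ?thesis by (simp add: algebra_simps)
qed

text \<open>The power mean inequality. Dividing each \<open>x i\<close> by the mean \<open>a\<close>
  makes the linear parts of the tangent bounds cancel in the sum.\<close>

lemma powr_sum_le:
  fixes x :: "'a \<Rightarrow> real"
  assumes A: "finite A" "A \<noteq> {}" and x: "\<And>i. i \<in> A \<Longrightarrow> 0 \<le> x i" and p: "1 < p"
  shows "(\<Sum>i\<in>A. x i) powr p \<le> real (card A) powr (p - 1) * (\<Sum>i\<in>A. x i powr p)"
proof (cases "(\<Sum>i\<in>A. x i) = 0")
  case True
  then show ?thesis by (auto intro!: mult_nonneg_nonneg sum_nonneg)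
next
  case False
  define n where "n = real (card A)"
  define a where "a = (\<Sum>i\<in>A. x i) / n"
  have n: "0 < n" using A by (simp add: n_def card_gt_0_iff)
  have S: "0 < (\<Sum>i\<in>A. x i)" using False x by (simp add: sum_nonneg less_le)
  have a: "0 < a" using n S by (simp add: a_def)
  have xa: "(\<Sum>i\<in>A. x i / a) = n"
    unfolding sum_divide_distrib[symmetric] using S n by (simp add: a_def)
  have "a powr p * n = a powr p * (\<Sum>i\<in>A. 1 + p * (x i / a - 1))"
    using xa by (simp add: sum.distrib sum_subtractf n_def flip: sum_distrib_left)
  also have "\<dots> \<le> a powr p * (\<Sum>i\<in>A. (x i / a) powr p)"
    using p a x by (intro mult_left_mono sum_mono powr_tangent_le) auto
  also have "\<dots> = (\<Sum>i\<in>A. x i powr p)"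
    using a x by (simp add: powr_divide sum_distrib_left)
  finally have "n powr (p - 1) * (a powr p * n) \<le> n powr (p - 1) * (\<Sum>i\<in>A. x i powr p)"
    by (rule mult_left_mono) simp
  moreover have "n powr (p - 1) * (a powr p * n) = (n * a) powr p"
    using n a by (simp add: powr_mult powr_diff)
  ultimately show ?thesis using n by (simp add: a_def n_def)
qed

section \<open>Euclidean geometry in coordinates\<close>

lemma rvec_norm_nonneg [simp]: "0 \<le> rvec_norm d x"
  by (simp add: rvec_norm_def)

lemma rvec_norm_power2: "(rvec_norm d x)\<^sup>2 = (\<Sum>i<d. (x i)\<^sup>2)"
  by (simp add: rvec_norm_def L2_set_def sum_nonneg)

lemma rvec_norm_scale: "rvec_norm d (\<lambda>i. x i / c) = rvec_norm d x / \<bar>c\<bar>"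
proof -
  have "rvec_norm d (\<lambda>i. x i / c) = sqrt ((\<Sum>i<d. (x i)\<^sup>2) / c\<^sup>2)"
    by (simp add: rvec_norm_def L2_set_def power_divide sum_divide_distrib)
  then show ?thesis by (simp add: rvec_norm_def L2_set_def real_sqrt_divide)
qed

lemma rvec_norm_add_power2:
  "(rvec_norm d (\<lambda>i. x i + y i))\<^sup>2 = (rvec_norm d x)\<^sup>2 + 2 * rvec_inner d x y + (rvec_norm d y)\<^sup>2"
  by (simp add: rvec_norm_power2 rvec_inner_def power2_sum sum.distrib sum_distrib_left mult.assoc)

lemma abs_rvec_inner_le: "\<bar>rvec_inner d x y\<bar> \<le> rvec_norm d x * rvec_norm d y"
  unfolding rvec_inner_def rvec_norm_def
  by (rule order_trans[OF sum_abs]) (simp add: abs_mult L2_set_mult_ineq)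

text \<open>\<open>cosh_sqrt_increment\<close> for both vectors scaled by \<open>l\<close>, with
  Cauchy-Schwarz supplying its hypothesis. The part linear in \<open>z\<close> is kept apart because
  it averages to zero over a centred vector.\<close>

lemma cosh_rvec_norm_add_le:
  fixes l :: real
  assumes l: "0 \<le> l"
  shows "cosh (l * rvec_norm d (\<lambda>i. a i + z i))
    \<le> cosh (l * rvec_norm d a) + l * sinh (l * rvec_norm d a) / rvec_norm d a * rvec_inner d a z
      + (exp (l * rvec_norm d z) - 1 - l * rvec_norm d z) * cosh (l * rvec_norm d a)"
proof (cases "l = 0")
  case False
  have "(l * rvec_norm d (\<lambda>i. a i + z i))\<^sup>2
      = (l * rvec_norm d a)\<^sup>2 + 2 * (l\<^sup>2 * rvec_inner d a z) + (l * rvec_norm d z)\<^sup>2"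
    by (simp add: power_mult_distrib rvec_norm_add_power2 algebra_simps)
  then have "l * rvec_norm d (\<lambda>i. a i + z i)
      = sqrt ((l * rvec_norm d a)\<^sup>2 + 2 * (l\<^sup>2 * rvec_inner d a z) + (l * rvec_norm d z)\<^sup>2)"
    using l by (metis real_sqrt_unique mult_nonneg_nonneg rvec_norm_nonneg)
  moreover have "\<bar>l\<^sup>2 * rvec_inner d a z\<bar> \<le> l * rvec_norm d a * (l * rvec_norm d z)"
    using mult_left_mono[OF abs_rvec_inner_le[of d a z], of "l\<^sup>2"]
    by (simp add: abs_mult power2_eq_square mult_ac)
  ultimately show ?thesis
    using cosh_sqrt_increment[of "l * rvec_norm d a" "l * rvec_norm d z" "l\<^sup>2 * rvec_inner d a z"] l False
    by (simp only: power2_eq_square mult_divide_mult_cancel_left times_divide_eq_left times_divide_eq_right mult_ac)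
      (simp add: mult_ac)
qed simp

section \<open>Truncation and the tail of a sum of independent centred vectors\<close>

definition rvec_trunc :: "nat \<Rightarrow> real \<Rightarrow> (nat \<Rightarrow> real) \<Rightarrow> (nat \<Rightarrow> real)" where
  "rvec_trunc d B y = (if rvec_norm d y \<le> B then y else (\<lambda>_. 0))"

lemma rvec_norm_zero [simp]: "rvec_norm d (\<lambda>_. 0) = 0"
  by (simp add: rvec_norm_def L2_set_def)

text \<open>What the tail argument uses of the law: mean zero, and a bound on the
  \<open>k\<close>-th moment of the norm in place of all directional moments.\<close>

locale centred_law = prob_space D for D :: "(nat \<Rightarrow> real) measure" +
  fixes d :: nat and k :: real
  assumes d: "1 \<le> d" and k: "2 < k"
    and sets_D [measurable_cong]: "sets D = sets (rvec_borel d)"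
    and integrable_coord: "\<And>i. i < d \<Longrightarrow> integrable D (\<lambda>y. y i)"
    and expectation_coord: "\<And>i. i < d \<Longrightarrow> expectation (\<lambda>y. y i) = 0"
    and integrable_norm_powr: "integrable D (\<lambda>y. rvec_norm d y powr k)"
    and expectation_norm_powr: "expectation (\<lambda>y. rvec_norm d y powr k) \<le> real d powr (k / 2)"
begin

lemma measurable_coord: "i < d \<Longrightarrow> (\<lambda>y. y i) \<in> borel_measurable D"
  using integrable_coord by blast

lemma measurable_norm [measurable]: "rvec_norm d \<in> borel_measurable D"
  unfolding rvec_norm_def L2_set_def
  by (intro measurable_compose[OF _ borel_measurable_sqrt] borel_measurable_sum borel_measurable_power) (auto intro: measurable_coord)

lemma measurable_trunc: "i < d \<Longrightarrow> (\<lambda>y. rvec_trunc d B y i) \<in> borel_measurable D"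
  unfolding rvec_trunc_def if_distrib[of "\<lambda>f. f i"] using measurable_coord[of i] by measurable

lemma measurable_sum_trunc [measurable]:
  "(\<lambda>x. rvec_norm d (\<lambda>i. \<Sum>j<m. rvec_trunc d B (x j) i)) \<in> borel_measurable (Pi\<^sub>M {..<m} (\<lambda>_. D))"
  unfolding rvec_norm_def L2_set_def
  by (intro measurable_compose[OF _ borel_measurable_sqrt] borel_measurable_sum borel_measurable_power
        measurable_compose[OF measurable_component_singleton[where M = "\<lambda>_. D"] measurable_trunc]) auto

lemma measurable_sum [measurable]:
  "(\<lambda>x. rvec_norm d (\<lambda>i. \<Sum>j<m. x j i)) \<in> borel_measurable (Pi\<^sub>M {..<m} (\<lambda>_. D))"
  unfolding rvec_norm_def L2_set_def
  by (intro measurable_compose[OF _ borel_measurable_sqrt] borel_measurable_sum borel_measurable_power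
        measurable_compose[OF measurable_component_singleton[where M = "\<lambda>_. D"] measurable_coord]) auto

text \<open>The tangent bound at exponent \<open>k / 2\<close> for \<open>z\<close>, the squared
  norm divided by \<open>d\<close>. It majorises the square by an affine function of the
  \<open>k\<close>-th power whose expectation is at most \<open>d\<close>, a pointwise substitute
  for Jensen's inequality.\<close>

lemma norm_power2_le:
  "(rvec_norm d y)\<^sup>2 \<le> real d * (1 + 2 / k * (rvec_norm d y powr k / real d powr (k / 2) - 1))"
proof -
  define z where "z = (rvec_norm d y)\<^sup>2 / real d"
  have zp: "z powr (k / 2) = rvec_norm d y powr k / real d powr (k / 2)"
    using d k by (simp add: z_def powr_divide powr_powr del: powr_numeral flip: powr_numeral)
  have "1 + k / 2 * (z - 1) \<le> z powr (k / 2)"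
    using k by (intro powr_tangent_le) (auto simp: z_def)
  then have "2 / k * (k / 2 * (z - 1)) \<le> 2 / k * (z powr (k / 2) - 1)"
    using k by (intro mult_left_mono) auto
  moreover have "2 / k * (k / 2 * (z - 1)) = z - 1" using k by simp
  ultimately have "z \<le> 1 + 2 / k * (z powr (k / 2) - 1)" by linarith
  then have "real d * z \<le> real d * (1 + 2 / k * (z powr (k / 2) - 1))"
    by (intro mult_left_mono) auto
  then show ?thesis using d unfolding zp by (simp add: z_def)
qed

text \<open>
  The linear term keeps the untruncated \<open>y\<close>, whose mean vanishes, so the truncated summands need
  no recentring; the error is absorbed into the \<open>k\<close>-th moment. For \<open>a = 0\<close> the quotient by the
  norm is \<open>0\<close>, which is harmless as the inner product vanishes too.
\<close>

lemma cosh_trunc_step_le: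
  assumes B: "0 < B" and th: "0 \<le> th"
  defines "l \<equiv> th / B"
  shows "cosh (l * rvec_norm d (\<lambda>i. a i + rvec_trunc d B y i))
    \<le> cosh (l * rvec_norm d a) * (1 + th * (rvec_norm d y powr k / B powr k)
        + 2 * exp (2 * th) / B\<^sup>2 * (real d * (1 + 2 / k * (rvec_norm d y powr k / real d powr (k / 2) - 1))))
      + l * sinh (l * rvec_norm d a) / rvec_norm d a * rvec_inner d a y" (is "_ \<le> ?C * (1 + ?Z + ?V) + ?q * _")
proof -
  let ?N = "rvec_norm d y" and ?na = "rvec_norm d a"
  have l: "0 \<le> l" using B th by (simp add: l_def)
  have sc: "sinh (l * ?na) \<le> ?C" by (rule sinh_le_cosh_real)
  have q: "0 \<le> ?q" using l by simp
  have V0: "0 \<le> 2 * exp (2 * th) / B\<^sup>2 * ?N\<^sup>2" by simp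
  have VV: "2 * exp (2 * th) / B\<^sup>2 * ?N\<^sup>2 \<le> ?V"
    by (intro mult_left_mono norm_power2_le) simp
  show ?thesis
  proof (cases "?N \<le> B")
    case True
    let ?b = "l * ?N"
    have b: "0 \<le> ?b" "?b \<le> th"
      using True l B th mult_left_mono[OF True l] by (auto simp: l_def)
    \<comment> \<open>Trades the polynomial factor \<open>th\<^sup>2\<close> for a second
      \<open>exp th\<close>; this is the origin of \<open>exp (2 * th)\<close>.\<close>
    have "th\<^sup>2 \<le> 2 * exp th"
      using exp_lower_Taylor_quadratic[OF th] th by simp
    then have "th\<^sup>2 * exp th \<le> 2 * exp th * exp th" by (intro mult_right_mono) auto
    then have te: "th\<^sup>2 * exp th \<le> 2 * exp (2 * th)" by (simp add: mult_exp_exp mult.assoc)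
    have "exp ?b - 1 - ?b \<le> ?b\<^sup>2 * exp ?b" by (rule exp_minus_linear_le[OF b(1)])
    also have "\<dots> \<le> ?b\<^sup>2 * exp th" using b by (intro mult_left_mono) auto
    also have "\<dots> = ?N\<^sup>2 / B\<^sup>2 * (th\<^sup>2 * exp th)" by (simp add: l_def power_divide power_mult_distrib)
    also have "\<dots> \<le> ?N\<^sup>2 / B\<^sup>2 * (2 * exp (2 * th))" using te by (intro mult_left_mono) auto
    also have "\<dots> \<le> ?Z + ?V" using VV th by (simp add: mult_ac add_increasing)
    finally have "(exp ?b - 1 - ?b) * ?C \<le> (?Z + ?V) * ?C" by (intro mult_right_mono) auto
    then show ?thesis
      using cosh_rvec_norm_add_le[OF l, of d a y] True by (simp add: rvec_trunc_def algebra_simps)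
  next
    case False
    \<comment> \<open>The summand is cut to zero, so the left side is \<open>?C\<close>, and a
      negative linear term has to be outweighed by \<open>?C * ?Z\<close>. This works because
      \<open>sinh \<le> cosh\<close>, and because \<open>?N / B > 1\<close> is at most its
      \<open>k\<close>-th power.\<close>
    have "- rvec_inner d a y \<le> ?na * ?N" using abs_rvec_inner_le[of d a y] by linarith
    then have "?q * (- rvec_inner d a y) \<le> ?q * (?na * ?N)" using q by (rule mult_left_mono)
    also have "\<dots> \<le> sinh (l * ?na) * (l * ?N)" by (cases "?na = 0") auto
    also have "\<dots> \<le> ?C * ?Z"
    proof (rule mult_mono[OF sc])
      have "?N / B \<le> (?N / B) powr k"
        using False B k powr_mono[of 1 k "?N / B"] by simp
      then have "th * (?N / B) \<le> th * (?N / B) powr k" using th by (rule mult_left_mono)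
      then show "l * ?N \<le> ?Z" using B by (simp add: l_def powr_divide)
    qed (use l in auto)
    finally have "- (?q * rvec_inner d a y) \<le> ?C * ?Z" by simp
    moreover have "0 \<le> ?C * ?V"
      by (rule mult_nonneg_nonneg[OF _ order_trans[OF V0 VV]]) simp
    ultimately have "?C \<le> ?C * (1 + ?Z + ?V) + ?q * rvec_inner d a y"
      unfolding distrib_left by linarith
    then show ?thesis using False by (simp add: rvec_trunc_def)
  qed
qed

text \<open>Integrate the pointwise bound over \<open>y\<close>: the linear term vanishes by
  centring, and the moment bound controls the rest. The constant \<open>3\<close> is
  \<open>1\<close> from the large vectors plus \<open>2\<close> from the second-order term.\<close>

lemma nn_integral_cosh_trunc_step_le:
  assumes B: "0 < B" "real d \<le> B\<^sup>2" and th: "0 \<le> th"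
  shows "(\<integral>\<^sup>+ y. ennreal (cosh (th / B * rvec_norm d (\<lambda>i. a i + rvec_trunc d B y i))) \<partial>D)
    \<le> ennreal (1 + 3 * exp (2 * th) * (real d / B\<^sup>2)) * ennreal (cosh (th / B * rvec_norm d a))"
proof -
  define C q where "C = cosh (th / B * rvec_norm d a)"
    and "q = th / B * sinh (th / B * rvec_norm d a) / rvec_norm d a"
  define e where "e = 2 * exp (2 * th) / B\<^sup>2"
  define G where "G y = C * (1 + th * (rvec_norm d y powr k / B powr k)
        + e * (real d * (1 + 2 / k * (rvec_norm d y powr k / real d powr (k / 2) - 1))))
      + q * rvec_inner d a y" for y
  let ?E = "expectation (\<lambda>y. rvec_norm d y powr k)"
  have C: "0 \<le> C" by (simp add: C_def)
  have e: "0 \<le> e" by (simp add: e_def)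
  \<comment> \<open>Written as an affine function of the \<open>k\<close>-th power, the bound
    commutes with the expectation.\<close>
  define c0 c1 where "c0 = C * (1 + e * (real d * (1 - 2 / k)))"
    and "c1 = C * (th / B powr k + e * (real d * (2 / k / real d powr (k / 2))))"
  have affine: "C * (1 + th * (z / B powr k) + e * (real d * (1 + 2 / k * (z / real d powr (k / 2) - 1))))
      = c0 + c1 * z" for z
    by (simp add: c0_def c1_def algebra_simps)
  have I: "integrable D (rvec_inner d a)"
    unfolding rvec_inner_def
    by (intro Bochner_Integration.integrable_sum integrable_mult_right integrable_coord) simp
  have I0: "expectation (rvec_inner d a) = 0"
    unfolding rvec_inner_def
    by (subst Bochner_Integration.integral_sum) (auto simp: integrable_coord expectation_coord)
  have G: "integrable D G"
    unfolding G_def affine using I integrable_norm_powr by simp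
  have GE: "expectation G = c0 + c1 * ?E"
    unfolding G_def affine using I integrable_norm_powr by (simp add: I0 prob_space)
  have le: "cosh (th / B * rvec_norm d (\<lambda>i. a i + rvec_trunc d B y i)) \<le> G y" for y
    using cosh_trunc_step_le[OF B(1) th, of a y] unfolding G_def C_def q_def e_def .
  have "?E / real d powr (k / 2) \<le> 1"
    using expectation_norm_powr d by simp
  then have "2 / k * (?E / real d powr (k / 2) - 1) \<le> 0"
    using k by (intro mult_nonneg_nonpos) auto
  then have 1: "1 + 2 / k * (?E / real d powr (k / 2) - 1) \<le> 1" by linarith
  \<comment> \<open>As \<open>d / B\<^sup>2 \<le> 1\<close> and \<open>k / 2 > 1\<close>, lowering
    the exponent \<open>k / 2\<close> to \<open>1\<close> only increases the power.\<close>
  have "?E / B powr k \<le> real d powr (k / 2) / B powr k"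
    by (intro divide_right_mono expectation_norm_powr) simp
  also have "\<dots> = (real d / B\<^sup>2) powr (k / 2)"
    using B(1) by (simp add: powr_divide powr_powr flip: powr_numeral)
  also have "\<dots> \<le> (real d / B\<^sup>2) powr 1"
    using B d k by (intro powr_mono') (auto simp: divide_le_eq_1)
  finally have "?E / B powr k \<le> real d / B\<^sup>2" using d by simp
  moreover have "th \<le> exp (2 * th)" using exp_ge_add_one_self[of "2 * th"] th by linarith
  moreover have "0 \<le> ?E" by (intro Bochner_Integration.integral_nonneg) simp
  ultimately have 2: "th * (?E / B powr k) \<le> exp (2 * th) * (real d / B\<^sup>2)"
    using th by (intro mult_mono) auto
  have "expectation G \<le> C * (1 + exp (2 * th) * (real d / B\<^sup>2) + e * (real d * 1))"
    unfolding GE affine[symmetric] using 1 2 C e by (intro mult_left_mono add_mono) auto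
  also have "\<dots> = (1 + 3 * exp (2 * th) * (real d / B\<^sup>2)) * C"
    by (simp add: e_def algebra_simps)
  finally have EG: "expectation G \<le> (1 + 3 * exp (2 * th) * (real d / B\<^sup>2)) * C" .
  have "(\<integral>\<^sup>+ y. ennreal (cosh (th / B * rvec_norm d (\<lambda>i. a i + rvec_trunc d B y i))) \<partial>D)
      \<le> (\<integral>\<^sup>+ y. ennreal (G y) \<partial>D)"
    using le by (intro nn_integral_mono ennreal_leI)
  also have "\<dots> = ennreal (expectation G)"
    using le by (intro nn_integral_eq_integral G AE_I2) (meson cosh_real_nonneg order_trans)
  also have "\<dots> \<le> ennreal ((1 + 3 * exp (2 * th) * (real d / B\<^sup>2)) * C)"
    by (rule ennreal_leI[OF EG])
  finally show ?thesis by (simp add: C_def ennreal_mult)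
qed

text \<open>Independence enters through Fubini: the last sample is integrated first, with the sum of
  the earlier ones held fixed as \<open>a\<close>, and contributes one factor.\<close>

lemma nn_integral_cosh_sum_trunc_le:
  assumes B: "0 < B" "real d \<le> B\<^sup>2" and th: "0 \<le> th"
  shows "(\<integral>\<^sup>+ x. ennreal (cosh (th / B * rvec_norm d (\<lambda>i. \<Sum>j<m. rvec_trunc d B (x j) i))) \<partial>Pi\<^sub>M {..<m} (\<lambda>_. D))
    \<le> ennreal ((1 + 3 * exp (2 * th) * (real d / B\<^sup>2)) ^ m)"
proof (induction m)
  case 0
  then show ?case by (simp add: PiM_empty nn_integral_count_space_finite)
next
  case (Suc m)
  interpret P: product_sigma_finite "\<lambda>_::nat. D" ..
  let ?r = "1 + 3 * exp (2 * th) * (real d / B\<^sup>2)"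
  let ?f = "\<lambda>m x. ennreal (cosh (th / B * rvec_norm d (\<lambda>i. \<Sum>j<m. rvec_trunc d B (x j) i)))"
  have "(\<integral>\<^sup>+ x. ?f (Suc m) x \<partial>Pi\<^sub>M (insert m {..<m}) (\<lambda>_. D))
      = (\<integral>\<^sup>+ x. (\<integral>\<^sup>+ y. ?f (Suc m) (x(m := y)) \<partial>D) \<partial>Pi\<^sub>M {..<m} (\<lambda>_. D))"
  proof (rule P.product_nn_integral_insert)
    have "?f (Suc m) \<in> borel_measurable (Pi\<^sub>M {..<Suc m} (\<lambda>_. D))"
      unfolding cosh_def by measurable
    then show "?f (Suc m) \<in> borel_measurable (Pi\<^sub>M (insert m {..<m}) (\<lambda>_. D))"
      by (simp only: lessThan_Suc)
  qed auto
  also have "\<dots> = (\<integral>\<^sup>+ x. (\<integral>\<^sup>+ y. ennreal (cosh (th / B * rvec_norm d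
      (\<lambda>i. (\<Sum>j<m. rvec_trunc d B (x j) i) + rvec_trunc d B y i))) \<partial>D) \<partial>Pi\<^sub>M {..<m} (\<lambda>_. D))"
    by simp
  also have "\<dots> \<le> (\<integral>\<^sup>+ x. ennreal ?r * ?f m x \<partial>Pi\<^sub>M {..<m} (\<lambda>_. D))"
    by (intro nn_integral_mono nn_integral_cosh_trunc_step_le assms)
  also have "\<dots> = ennreal ?r * (\<integral>\<^sup>+ x. ?f m x \<partial>Pi\<^sub>M {..<m} (\<lambda>_. D))"
    unfolding cosh_def by (rule nn_integral_cmult) measurable
  also have "\<dots> \<le> ennreal ?r * ennreal (?r ^ m)"
    by (intro mult_left_mono Suc.IH) simp
  also have "\<dots> = ennreal (?r ^ Suc m)"
    by (subst ennreal_mult[symmetric]) auto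
  finally show ?case by (simp only: lessThan_Suc)
qed

text \<open>If every sample has norm below \<open>B\<close>, truncation changes nothing, so the
  event is covered by the sets \<open>A j\<close> and \<open>F\<close>. Markov's inequality bounds
  the former through the \<open>k\<close>-th power and the latter through
  \<open>cosh\<close>.\<close>

lemma prob_sum_ge_le:
  assumes B: "0 < B" "real d \<le> B\<^sup>2" and th: "0 \<le> th"
  shows "measure (Pi\<^sub>M {..<m} (\<lambda>_. D)) {x \<in> space (Pi\<^sub>M {..<m} (\<lambda>_. D)). u \<le> rvec_norm d (\<lambda>i. \<Sum>j<m. x j i)}
    \<le> real m * (real d powr (k / 2) / B powr k)
      + 2 * exp (3 * exp (2 * th) * (real m * real d / B\<^sup>2) - th * u / B)"
proof -
  let ?P = "Pi\<^sub>M {..<m} (\<lambda>_. D)"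
  interpret P: prob_space ?P by (rule prob_space_PiM) (rule prob_space_axioms)
  define S where "S x = rvec_norm d (\<lambda>i. \<Sum>j<m. rvec_trunc d B (x j) i)" for x
  define r where "r = 1 + 3 * exp (2 * th) * (real d / B\<^sup>2)"
  have S [measurable]: "S \<in> borel_measurable ?P" unfolding S_def by measurable
  define A where "A j = {x \<in> space ?P. B \<le> rvec_norm d (x j)}" for j
  define F where "F = {x \<in> space ?P. u \<le> S x}"
  have [measurable]: "(\<lambda>x. rvec_norm d (x j)) \<in> borel_measurable ?P" if "j < m" for j
    using that by (intro measurable_compose[OF measurable_component_singleton[where M = "\<lambda>_. D"] measurable_norm]) auto
  have A [measurable]: "A j \<in> P.events" if "j < m" for j
    unfolding A_def using that by measurable
  have F [measurable]: "F \<in> P.events" unfolding F_def by measurable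
  have PA: "P.prob (A j) \<le> real d powr (k / 2) / B powr k" if j: "j < m" for j
  proof -
    have "P.prob (A j) = measure (distr ?P D (\<lambda>x. x j)) {y \<in> space D. B \<le> rvec_norm d y}"
      using j by (subst measure_distr) (auto simp: A_def space_PiM intro!: arg_cong[where f = P.prob])
    also have "distr ?P D (\<lambda>x. x j) = D"
      using j by (intro distr_PiM_component prob_space_axioms) auto
    also have "prob {y \<in> space D. B \<le> rvec_norm d y} \<le> prob {y \<in> space D. B powr k \<le> rvec_norm d y powr k}"
      using B k by (intro finite_measure_mono) (auto intro!: powr_mono2)
    also have "\<dots> \<le> expectation (\<lambda>y. rvec_norm d y powr k) / B powr k"
      using B integrable_norm_powr by (intro integral_Markov_inequality_measure[where A = "{}"]) auto
    also have "\<dots> \<le> real d powr (k / 2) / B powr k"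
      by (intro divide_right_mono expectation_norm_powr) simp
    finally show ?thesis .
  qed
  have PF: "P.prob F \<le> 2 * exp (3 * exp (2 * th) * (real m * real d / B\<^sup>2) - th * u / B)"
  proof -
    \<comment> \<open>On \<open>F\<close> the \<open>cosh\<close> is at least half the exponential,
      which causes the factor \<open>2\<close> in the result.\<close>
    let ?c = "exp (th * u / B) / 2"
    let ?W = "{x \<in> space ?P. 1 \<le> ennreal (1 / ?c) * ennreal (cosh (th / B * S x))}"
    have W: "?W \<in> P.events" unfolding cosh_def by measurable
    have "emeasure ?P ?W
        \<le> ennreal (1 / ?c) * (\<integral>\<^sup>+ x. ennreal (cosh (th / B * S x)) * indicator (space ?P) x \<partial>?P)"
      unfolding cosh_def by (intro nn_integral_Markov_inequality) auto
    also have "(\<integral>\<^sup>+ x. ennreal (cosh (th / B * S x)) * indicator (space ?P) x \<partial>?P)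
        = (\<integral>\<^sup>+ x. ennreal (cosh (th / B * S x)) \<partial>?P)"
      by (intro nn_integral_cong) auto
    also have "\<dots> \<le> ennreal (r ^ m)"
      unfolding S_def r_def by (rule nn_integral_cosh_sum_trunc_le[OF assms])
    also have "ennreal (1 / ?c) * ennreal (r ^ m) = ennreal (1 / ?c * r ^ m)"
      by (simp add: r_def ennreal_mult[symmetric])
    finally have EW: "emeasure ?P ?W
        \<le> ennreal (1 / ?c * r ^ m)"
      by (simp add: mult_left_mono)
    have FW: "F \<subseteq> ?W"
    proof
      fix x assume x: "x \<in> F"
      then have "th * u / B \<le> th / B * S x"
        using B th by (auto simp: F_def divide_right_mono mult_left_mono)
      then have "exp (th * u / B) \<le> exp (th / B * S x)" by simp
      then have "?c \<le> cosh (th / B * S x)"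
        unfolding cosh_def by (simp add: add_increasing2)
      then have "1 \<le> 1 / ?c * cosh (th / B * S x)"
        by (simp add: field_simps)
      then have "ennreal 1 \<le> ennreal (1 / ?c * cosh (th / B * S x))" by (rule ennreal_leI)
      then show "x \<in> ?W"
        using x by (subst ennreal_mult[symmetric]) (auto simp: F_def)
    qed
    have "emeasure ?P F \<le> ennreal (1 / ?c * r ^ m)"
      using emeasure_mono[OF FW W] EW by (rule order_trans)
    then have "P.prob F \<le> 1 / ?c * r ^ m"
      by (simp add: P.emeasure_eq_measure r_def)
    also have "\<dots> \<le> 1 / ?c * exp (3 * exp (2 * th) * (real d / B\<^sup>2)) ^ m"
      unfolding r_def by (intro mult_left_mono power_mono) auto
    also have "\<dots> = 2 * exp (3 * exp (2 * th) * (real m * real d / B\<^sup>2) - th * u / B)"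
      by (simp add: exp_diff exp_of_nat_mult[symmetric] mult_ac)
    finally show ?thesis .
  qed
  have "{x \<in> space ?P. u \<le> rvec_norm d (\<lambda>i. \<Sum>j<m. x j i)} \<subseteq> (\<Union>j<m. A j) \<union> F"
  proof
    fix x assume x: "x \<in> {x \<in> space ?P. u \<le> rvec_norm d (\<lambda>i. \<Sum>j<m. x j i)}"
    show "x \<in> (\<Union>j<m. A j) \<union> F"
    proof (cases "\<exists>j<m. B \<le> rvec_norm d (x j)")
      case False
      then have "(\<lambda>i. \<Sum>j<m. x j i) = (\<lambda>i. \<Sum>j<m. rvec_trunc d B (x j) i)"
        by (intro ext sum.cong) (auto simp: rvec_trunc_def not_le)
      then show ?thesis using x by (simp add: F_def S_def)
    qed (use x in \<open>auto simp: A_def\<close>)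
  qed
  then have "P.prob {x \<in> space ?P. u \<le> rvec_norm d (\<lambda>i. \<Sum>j<m. x j i)} \<le> P.prob ((\<Union>j<m. A j) \<union> F)"
    by (intro P.finite_measure_mono) auto
  also have "\<dots> \<le> P.prob (\<Union>j<m. A j) + P.prob F"
    by (intro measure_Un_le) auto
  also have "P.prob (\<Union>j<m. A j) \<le> (\<Sum>j<m. P.prob (A j))"
    by (intro measure_UNION_le) auto
  also have "\<dots> \<le> (\<Sum>j<m. real d powr (k / 2) / B powr k)"
    by (intro sum_mono PA) auto
  finally show ?thesis using PF by simp
qed

end

section \<open>From directional moments to the moment of the norm\<close>

lemma nn_integral_coord_powr_le:
  assumes D: "rvec_distribution d D" and mean: "mean_zero d D" and sigma: "sigma_moment k d D \<le> 1"
    and k: "0 < k" and i: "i < d"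
  shows "(\<integral>\<^sup>+ y. ennreal (\<bar>y i\<bar> powr k) \<partial>D) \<le> 1"
proof -
  \<comment> \<open>The \<open>i\<close>-th basis vector picks out one coordinate; the restriction
    places it in \<open>rvec d\<close>, over which the supremum runs.\<close>
  define v :: "nat \<Rightarrow> real" where "v = (\<lambda>j\<in>{..<d}. if j = i then 1 else 0)"
  let ?I = "\<integral>\<^sup>+ y. ennreal (\<bar>y i\<bar> powr k) \<partial>D"
  have "rvec_norm d v = sqrt (\<Sum>j<d. if j = i then 1 else 0)"
    unfolding rvec_norm_def L2_set_def
    by (intro arg_cong[where f = sqrt] sum.cong) (auto simp: v_def)
  then have v: "v \<in> rvec d" "rvec_norm d v = 1"
    using i by (auto simp: v_def rvec_def)
  have "mean_vec d D j = 0" if "j < d" for j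
    using mean that by (simp add: mean_zero_def)
  then have "rvec_inner d (\<lambda>j. y j - mean_vec d D j) v = (\<Sum>j<d. if j = i then y j else 0)" for y
    unfolding rvec_inner_def by (intro sum.cong) (auto simp: v_def)
  then have inner: "rvec_inner d (\<lambda>j. y j - mean_vec d D j) v = y i" for y
    using i by simp
  have "ennreal_powr ?I (1 / k) \<le> sigma_moment k d D"
    unfolding sigma_moment_def by (rule SUP_upper2[of v]) (use v in \<open>auto simp: inner\<close>)
  then have le: "ennreal_powr ?I (1 / k) \<le> 1" using sigma by (rule order_trans)
  then have fin: "?I \<noteq> top" by (auto simp: ennreal_powr_def top_unique)
  then have I: "?I = ennreal (enn2real ?I)" by (simp add: less_top)
  have "ennreal (enn2real ?I powr (1 / k)) \<le> 1"
    using le fin by (simp add: ennreal_powr_def)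
  then have "enn2real ?I powr (1 / k) \<le> 1" by (simp only: ennreal_le_1)
  then have "(enn2real ?I powr (1 / k)) powr k \<le> 1 powr k"
    using k by (intro powr_mono2) auto
  then have "enn2real ?I \<le> 1" using k by (simp add: powr_powr)
  then show ?thesis by (subst I) simp
qed

text \<open>The power mean inequality with exponent \<open>k / 2\<close> on the squared coordinates.
  With \<open>d\<close> coordinate moments of at most \<open>1\<close>, the prefactor gives exactly
  \<open>d powr (k / 2)\<close>.\<close>

lemma rvec_norm_powr_le:
  assumes d: "1 \<le> d" and k: "2 < k"
  shows "rvec_norm d y powr k \<le> real d powr (k / 2 - 1) * (\<Sum>i<d. \<bar>y i\<bar> powr k)"
proof -
  have sq: "(x\<^sup>2) powr (k / 2) = \<bar>x\<bar> powr k" for x :: real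
    using powr_powr[of "\<bar>x\<bar>" 2 "k / 2"] by simp
  have "rvec_norm d y powr k = (\<Sum>i<d. (y i)\<^sup>2) powr (k / 2)"
    unfolding rvec_norm_power2[symmetric] sq by simp
  also have "\<dots> \<le> real d powr (k / 2 - 1) * (\<Sum>i<d. ((y i)\<^sup>2) powr (k / 2))"
    using powr_sum_le[of "{..<d}" "\<lambda>i. (y i)\<^sup>2" "k / 2"] d k by (auto simp: lessThan_empty_iff)
  finally show ?thesis by (simp only: sq)
qed

lemma centred_lawI:
  assumes d: "1 \<le> d" and k: "2 < k" and D: "rvec_distribution d D" and mean: "mean_zero d D"
    and sigma: "sigma_moment k d D \<le> 1"
  shows "centred_law D d k"
proof -
  interpret prob_space D using D by (simp add: rvec_distribution_def)
  have sets_D: "sets D = sets (rvec_borel d)" using D by (simp add: rvec_distribution_def)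
  have coord: "integrable D (\<lambda>y. y i)" if "i < d" for i
    using mean that by (simp add: mean_zero_def)
  have coord0: "expectation (\<lambda>y. y i) = 0" if "i < d" for i
    using mean that unfolding mean_zero_def mean_vec_def
    by (metis (no_types, lifting) restrict_apply' lessThan_iff)
  have meas: "(\<lambda>y. y i) \<in> borel_measurable D" if "i < d" for i
    using coord[OF that] by blast
  have norm_meas [measurable]: "rvec_norm d \<in> borel_measurable D"
    unfolding rvec_norm_def L2_set_def
    by (intro measurable_compose[OF _ borel_measurable_sqrt] borel_measurable_sum borel_measurable_power)
       (auto intro: meas)
  have "(\<integral>\<^sup>+ y. ennreal (rvec_norm d y powr k) \<partial>D)
      \<le> (\<integral>\<^sup>+ y. ennreal (real d powr (k / 2 - 1)) * (\<Sum>i<d. ennreal (\<bar>y i\<bar> powr k)) \<partial>D)"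
    using rvec_norm_powr_le[OF d k]
    by (intro nn_integral_mono) (simp add: sum_nonneg ennreal_leI flip: ennreal_mult)
  also have "\<dots> = ennreal (real d powr (k / 2 - 1)) * (\<Sum>i<d. \<integral>\<^sup>+ y. ennreal (\<bar>y i\<bar> powr k) \<partial>D)"
    using meas by (subst nn_integral_cmult, simp, subst nn_integral_sum) auto
  also have "\<dots> \<le> ennreal (real d powr (k / 2 - 1)) * (\<Sum>i<d. 1)"
    using k by (intro mult_left_mono sum_mono nn_integral_coord_powr_le[OF D mean sigma]) auto
  also have "\<dots> = ennreal (real d powr (k / 2))"
    using d by (simp add: powr_diff ennreal_of_nat_eq_real_of_nat flip: ennreal_mult)
  finally have le: "(\<integral>\<^sup>+ y. ennreal (rvec_norm d y powr k) \<partial>D) \<le> ennreal (real d powr (k / 2))" .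
  have int: "integrable D (\<lambda>y. rvec_norm d y powr k)"
    using le by (intro integrableI_bounded) (auto intro: order_le_less_trans)
  have "ennreal (expectation (\<lambda>y. rvec_norm d y powr k)) \<le> ennreal (real d powr (k / 2))"
    using le by (subst nn_integral_eq_integral[OF int, symmetric]) auto
  then have "expectation (\<lambda>y. rvec_norm d y powr k) \<le> real d powr (k / 2)"
    by simp
  then show ?thesis
    by unfold_locales (use d k sets_D coord coord0 int in auto)
qed

section \<open>Choice of parameters and assembly of the tail bound\<close>

lemma exp_tilt_le:
  fixes m k w :: real
  assumes m: "1 \<le> m" and k: "2 < k" and w: "0 < w"
    and L: "L = 2 * k * (1 + ln m)" and q: "q = w\<^sup>2 / (m * L)" "exp 12 \<le> q"
  shows "exp (3 * q * (m * L\<^sup>2 / w\<^sup>2) - ln q / 2 * L) \<le> m * (L / w) powr k"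
proof -
  have lm: "0 \<le> ln m" using m by simp
  have L1: "1 \<le> L" using k lm mult_mono[of 1 "2 * k" 1 "1 + ln m"] by (simp add: L)
  have q0: "0 < q" by (rule less_le_trans[OF exp_gt_zero q(2)])
  have lq: "12 \<le> ln q" using q(2) q0 by (simp add: ln_ge_iff)
  have wq: "w\<^sup>2 = q * (m * L)" using m L1 by (simp add: q(1))
  \<comment> \<open>The positive part of the exponent is \<open>3 * L\<close>. The threshold
    \<open>ln q \<ge> 12\<close> makes it at most half of the negative part
    \<open>L * ln q / 2\<close>.\<close>
  have "3 * q * (m * L\<^sup>2 / w\<^sup>2) = 3 * L"
    unfolding wq using m L1 q0 by (simp add: power2_eq_square)
  moreover have "L * 12 \<le> L * ln q" using lq L1 by (intro mult_left_mono) auto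
  ultimately have "3 * q * (m * L\<^sup>2 / w\<^sup>2) - ln q / 2 * L \<le> - (L * ln q / 4)"
    by (simp add: mult.commute)
  \<comment> \<open>The two summands of \<open>L\<close> now give a power of \<open>q\<close> and a
    power of \<open>m\<close>.\<close>
  also have "- (L * ln q / 4) = - (k / 2 * ln q) - k / 2 * ln m * ln q"
    by (simp add: L algebra_simps)
  also have "\<dots> \<le> - (k / 2 * ln q) - k / 2 * ln m * 12"
    using k lm lq by (intro diff_left_mono mult_left_mono) auto
  also have "\<dots> = - (k / 2) * ln q + (- 6 * k) * ln m" by simp
  finally have "exp (3 * q * (m * L\<^sup>2 / w\<^sup>2) - ln q / 2 * L) \<le> q powr (- (k / 2)) * m powr (- 6 * k)"
    using q0 m by (simp add: powr_def flip: exp_add)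
  also have "q powr (- (k / 2)) = (m * L) powr (k / 2) / w powr k"
    using w m L1 unfolding q(1)
    by (simp add: powr_minus powr_divide powr_powr del: powr_numeral flip: powr_numeral)
  also have "\<dots> * m powr (- 6 * k) = m powr (k / 2 - 6 * k) * (L powr (k / 2) / w powr k)"
    using m L1 powr_add[of m "k / 2" "- 6 * k"] by (simp add: powr_mult)
  \<comment> \<open>The factor \<open>m powr (- 6 * k)\<close> has absorbed the \<open>m\<close>
    inside \<open>(m * L) powr (k / 2)\<close>, leaving an exponent below \<open>1\<close>.\<close>
  also have "\<dots> \<le> m powr 1 * (L powr k / w powr k)"
    using m k L1 by (intro mult_mono divide_right_mono powr_mono) auto
  finally show ?thesis using m L1 w by (simp add: powr_divide)
qed

theorem theorem4p4:
  fixes k :: real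
  assumes "k > 2"
  shows "\<exists>C1 > (0::real). \<exists>C2 > (0::real). \<exists>p::nat.
    \<forall>d::nat. \<forall>m::nat. \<forall>D :: (nat \<Rightarrow> real) measure.
      d \<ge> 1 \<longrightarrow> m \<ge> 1 \<longrightarrow>
      rvec_distribution d D \<longrightarrow> mean_zero d D \<longrightarrow> sigma_moment k d D \<le> 1 \<longrightarrow>
      (\<exists>t1::real. 0 \<le> t1 \<and> t1 \<le> C1 * sqrt (real d * ln (real m) / real m) \<and>
        (\<forall>t \<ge> t1.
          measure (iid_sample m D)
            {x \<in> space (iid_sample m D). rvec_norm d (sample_mean d m x) \<ge> t}
          \<le> C2 * (1 + ln (real m)) ^ p *
             (real d powr (k / 2) / (real m powr (k - 1) * t powr k)
              + exp (- (real m * t\<^sup>2 / real d)))))"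
proof -
  \<comment> \<open>Chosen so that \<open>t \<ge> t1\<close> gives
    \<open>?s \<ge> exp 12 * (2 * k * (3 * ln m))\<close>, which is at least
    \<open>exp 12 * L\<close> once \<open>ln m \<ge> 1 / 2\<close>, that is for
    \<open>m \<ge> 2\<close>.\<close>
  define C1 where "C1 = sqrt (6 * k * exp 12)"
  \<comment> \<open>The first summand serves the polynomial bound; the second offsets
    \<open>exp (- ?s)\<close> when \<open>m = 1\<close>.\<close>
  define C2 where "C2 = 3 * (2 * k) powr k + exp (2 * k * exp 12)"
  define p where "p = nat \<lceil>k\<rceil>"
  have C: "0 < C1" "0 < C2" using assms by (auto simp: C1_def C2_def add_nonneg_pos)
  have bound: "measure (iid_sample m D)
        {x \<in> space (iid_sample m D). rvec_norm d (sample_mean d m x) \<ge> t}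
      \<le> C2 * (1 + ln (real m)) ^ p *
         (real d powr (k / 2) / (real m powr (k - 1) * t powr k) + exp (- (real m * t\<^sup>2 / real d)))"
    (is "?P \<le> C2 * ?l ^ p * (?R + exp (- ?s))")
    if d: "1 \<le> d" and m: "1 \<le> m" and D: "rvec_distribution d D" "mean_zero d D" "sigma_moment k d D \<le> 1"
      and t: "C1 * sqrt (real d * ln (real m) / real m) \<le> t"
    for d m :: nat and D :: "(nat \<Rightarrow> real) measure" and t :: real
  proof -
    interpret centred_law D d k by (rule centred_lawI[OF d assms D])
    interpret P: prob_space "iid_sample m D"
      unfolding iid_sample_def by (rule prob_space_PiM) (rule prob_space_axioms)
    define L where "L = 2 * k * (1 + ln (real m))"
    have lm: "0 \<le> ln (real m)" using m by simp
    have "0 \<le> C1 * sqrt (real d * ln (real m) / real m)" using C lm by simp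
    then have t0: "0 \<le> t" using t by linarith
    have R: "0 \<le> ?R" by simp
    have L1: "1 \<le> L" using k lm mult_mono[of 1 "2 * k" 1 "1 + ln (real m)"] by (simp add: L_def)
    have lp: "?l powr k \<le> ?l ^ p"
    proof -
      have "k \<le> real p" unfolding p_def by (rule of_nat_ceiling)
      then have "?l powr k \<le> ?l powr real p" using lm by (intro powr_mono) auto
      then show ?thesis using lm by (simp add: powr_realpow)
    qed
    have sd: "sqrt (real d) powr k = real d powr (k / 2)"
      by (simp add: powr_powr flip: powr_half_sqrt)
    show ?thesis
    proof (cases "exp 12 * L \<le> ?s")
      case False
      have "(C1 * sqrt (real d * ln (real m) / real m))\<^sup>2 \<le> t\<^sup>2"
        using t C lm by (intro power_mono) auto
      then have "real m / real d * (6 * k * exp 12 * (real d * ln (real m) / real m)) \<le> real m / real d * t\<^sup>2"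
        using k lm by (intro mult_left_mono) (auto simp: C1_def power_mult_distrib)
      then have "exp 12 * (2 * k * (3 * ln (real m))) \<le> ?s" using d m by (simp add: mult_ac)
      then have "exp 12 * (2 * k * (3 * ln (real m))) < exp 12 * (2 * k * (1 + ln (real m)))"
        using False unfolding L_def by linarith
      then have "ln (real m) < 1 / 2" using k by simp
      moreover have "1 / 2 \<le> ln (real m)" if "2 \<le> m"
      proof -
        have "1 / 2 \<le> ln (2::real)" using ln_ge_iff[of 2 "1/2"] exp_half_le2 by simp
        also have "\<dots> \<le> ln (real m)" using that by simp
        finally show ?thesis .
      qed
      ultimately have m1: "m = 1" using m by (cases "2 \<le> m") auto
      then have "?s \<le> 2 * k * exp 12" using False by (simp add: L_def mult.commute)
      then have "1 \<le> exp (2 * k * exp 12) * exp (- ?s)" by (simp flip: exp_add)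
      \<comment> \<open>Only \<open>0 \<le> ?R\<close> enters, so \<open>t = 0\<close> is covered,
        where the quotient \<open>?R\<close> is zero by convention.\<close>
      also have "\<dots> \<le> C2 * (?R + exp (- ?s))"
        using R by (intro mult_mono) (auto simp: C2_def)
      finally have "1 \<le> C2 * ?l ^ p * (?R + exp (- ?s))" by (simp add: m1)
      then show ?thesis by (rule order_trans[OF P.prob_le_1])
    next
      case True
      \<comment> \<open>In these units \<open>w\<^sup>2 = m * ?s\<close>, and \<open>L / w\<close>
        is \<open>sqrt d / B\<close>.\<close>
      define w where "w = real m * t / sqrt (real d)"
      define B where "B = real m * t / L"
      define q where "q = w\<^sup>2 / (real m * L)"
      have "0 < exp 12 * L" using L1 by simp
      then have "0 < ?s" using True by linarith
      then have "t \<noteq> 0" by auto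
      with t0 have t0: "0 < t" by simp
      have w: "0 < w" using t0 d m by (simp add: w_def)
      have ws: "w\<^sup>2 = real m * ?s" using d by (simp add: w_def power_mult_distrib power_divide power2_eq_square)
      have qs: "q = ?s / L" unfolding q_def ws using m by simp
      have q12: "exp 12 \<le> q"
        unfolding qs by (subst pos_le_divide_eq) (use True L1 in linarith)+
      have q0: "0 < q" by (rule less_le_trans[OF exp_gt_zero q12])
      have wk: "w powr k = real m powr k * t powr k / real d powr (k / 2)"
        unfolding w_def using m t0 by (simp only: powr_divide powr_mult sd of_nat_0_le_iff
            real_sqrt_ge_zero less_imp_le mult_nonneg_nonneg)
      have mk: "real m powr (k - 1) = real m powr k / real m"
        using m by (simp add: powr_diff)
      have poly: "?R = real m * (1 / w powr k)"
        unfolding wk mk by simp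
      have Lk: "(L / w) powr k = (2 * k) powr k * ?l powr k * (1 / w powr k)"
        using k lm w by (simp add: L_def powr_divide powr_mult)
      \<comment> \<open>One copy comes from the union bound, two from the \<open>cosh\<close>
        term.\<close>
      have main: "?P \<le> 3 * (real m * (L / w) powr k)"
      proof (cases "w < L")
        case True
        then have "1 * 1 \<le> real m * (L / w) powr k"
          using m w k by (intro mult_mono ge_one_powr_ge_zero) auto
        then have "1 \<le> 3 * (real m * (L / w) powr k)" by linarith
        then show ?thesis by (rule order_trans[OF P.prob_le_1])
      next
        case False
        have B: "0 < B" using t0 m L1 by (simp add: B_def)
        have dB: "real d / B\<^sup>2 = (L / w)\<^sup>2"
          using d by (simp add: B_def w_def power_divide power_mult_distrib)
        have "(L / w)\<^sup>2 \<le> 1" using False L1 w by (intro power_le_one) auto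
        then have d_le: "real d \<le> B\<^sup>2" using B unfolding dB[symmetric] by (simp add: divide_le_eq)
        have Bw: "real d powr (k / 2) / B powr k = (L / w) powr k"
          using t0 m L1 by (simp add: B_def w_def powr_divide powr_mult sd)
        have uB: "real m * t / B = L" using t0 m L1 by (simp add: B_def)
        \<comment> \<open>The tilt is \<open>th = ln q / 2\<close>, so that
          \<open>exp (2 * th) = q\<close>.\<close>
        have th: "0 \<le> ln q / 2" using q12 q0 order_trans[of 1 "exp 12" q] by simp
        have norm: "rvec_norm d (sample_mean d m x) = rvec_norm d (\<lambda>i. \<Sum>j<m. x j i) / real m" for x
        proof -
          have "rvec_norm d (sample_mean d m x) = rvec_norm d (\<lambda>i. (\<Sum>j<m. x j i) / real m)"
            unfolding rvec_norm_def by (intro L2_set_cong) (auto simp: sample_mean_def)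
          then show ?thesis by (simp add: rvec_norm_scale)
        qed
        have "?P = measure (Pi\<^sub>M {..<m} (\<lambda>_. D))
            {x \<in> space (Pi\<^sub>M {..<m} (\<lambda>_. D)). real m * t \<le> rvec_norm d (\<lambda>i. \<Sum>j<m. x j i)}"
          unfolding norm iid_sample_def using m by (simp add: pos_le_divide_eq mult.commute)
        also have "\<dots> \<le> real m * (real d powr (k / 2) / B powr k)
            + 2 * exp (3 * exp (2 * (ln q / 2)) * (real m * real d / B\<^sup>2) - ln q / 2 * (real m * t) / B)"
          by (rule prob_sum_ge_le[OF B d_le th])
        also have "ln q / 2 * (real m * t) / B = ln q / 2 * L"
          unfolding uB[symmetric] by (rule times_divide_eq_right[symmetric])
        also have "real m * real d / B\<^sup>2 = real m * L\<^sup>2 / w\<^sup>2"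
          by (simp only: times_divide_eq_right[symmetric] dB power_divide)
        also have "exp (2 * (ln q / 2)) = q" using q0 by simp
        also have "exp (3 * q * (real m * L\<^sup>2 / w\<^sup>2) - ln q / 2 * L) \<le> real m * (L / w) powr k"
          using m by (intro exp_tilt_le[OF _ k w L_def q_def q12]) simp
        finally show ?thesis unfolding Bw by simp
      qed
      also have "3 * (real m * (L / w) powr k) = 3 * (2 * k) powr k * ?l powr k * ?R"
        unfolding Lk poly by simp
      also have "\<dots> \<le> C2 * ?l ^ p * (?R + exp (- ?s))"
        using lp R lm C by (intro mult_mono) (auto simp: C2_def)
      finally show ?thesis .
    qed
  qed
  show ?thesis
  proof (rule exI[of _ C1], rule conjI[OF C(1)], rule exI[of _ C2], rule conjI[OF C(2)],
      rule exI[of _ p], intro allI impI)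
    fix d m :: nat and D :: "(nat \<Rightarrow> real) measure"
    assume "1 \<le> d" "1 \<le> m" "rvec_distribution d D" "mean_zero d D" "sigma_moment k d D \<le> 1"
    from bound[OF this] C \<open>1 \<le> m\<close>
    show "\<exists>t1\<ge>0. t1 \<le> C1 * sqrt (real d * ln (real m) / real m) \<and> (\<forall>t\<ge>t1.
        measure (iid_sample m D) {x \<in> space (iid_sample m D). t \<le> rvec_norm d (sample_mean d m x)}
        \<le> C2 * (1 + ln (real m)) ^ p * (real d powr (k / 2) / (real m powr (k - 1) * t powr k)
          + exp (- (real m * t\<^sup>2 / real d))))"
      by (intro exI[of _ "C1 * sqrt (real d * ln (real m) / real m)"]) auto
  qed
qed

end
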